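(* Let $G_1$ be an arbitrary finite simple connected graph with $n_1$ vertices, let $G_2$ be a regular highly symmetric graph with $n_2$ vertices, and let $G=G_1\{G_2\}$ be their cluster (formed with respect to any choice of vertex of $G_2$). Then the Kirchhoff indices satisfy $$R(G)=n_2^2\,R(G_1)+(2n_1^2-n_1)\,R(G_2).$$
   Context: All graphs are finite, simple, connected and undirected. For a graph $G$ and vertices $i,j$, $R_{ij}$ denotes the effective resistance between $i$ and $j$ when $G$ is viewed as an electric network with a unit resistor on each edge. The Kirchhoff index of $G$ is $R(G)=\sum_{i<j}R_{ij}$, the sum being over unordered pairs of distinct vertices. The simple random walk $(X_n)$ on a graph jumps from a vertex to a uniformly chosen neighbor. The hitting time of a vertex $b$ is $T_b=\inf\{n\ge 0: X_n=b\}$, and $E_aT_b$ denotes its expectation when the walk starts at $a$. A graph is highly symmetric (HS) if $E_aT_b=E_bT_a$ for all vertices $a,b$. The cluster $G_1\{G_2\}$ of $G_1=(V_1,E_1)$ and $G_2$ is the graph obtained by selecting one vertex $r$ of $G_2$, taking $|V_1|$ disjoint copies of $G_2$, one for each vertex of $G_1$, and identifying the copy of $r$ in the copy of $G_2$ associated with $v\in V_1$ with the vertex $v$, for every $v\in V_1$. *)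

theory Defs
  imports
    "Graph_Theory.Graph_Theory"
    "HOL-Probability.Probability"
begin

text \<open>
  Graphs are the symmetric loop-free pair digraphs of \<open>Graph_Theory\<close>: an undirected edge between
  \<open>x\<close> and \<open>y\<close> is the pair of arcs \<open>(x, y)\<close> and \<open>(y, x)\<close>. The qualified name below avoids the
  topological \<open>connected\<close>; it includes that the vertex set is nonempty.
\<close>

definition connected_graph :: "'a pair_pre_digraph \<Rightarrow> bool" where
  "connected_graph G \<longleftrightarrow> pair_graph G \<and> Digraph_Component.connected (with_proj G)"

definition neighbours :: "'a pair_pre_digraph \<Rightarrow> 'a \<Rightarrow> 'a set" where
  "neighbours G x = {y. (x, y) \<in> parcs G}"

definition regular_graph :: "'a pair_pre_digraph \<Rightarrow> bool" where
  "regular_graph G \<longleftrightarrow> (\<exists>d. \<forall>x\<in>pverts G. card (neighbours G x) = d)"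


subsection \<open>Effective resistance and Kirchhoff index\<close>

text \<open>
  By Ohm's law, a potential \<open>\<phi>\<close> drives the current \<open>\<phi> x - \<phi> y\<close> through the unit resistor from
  \<open>x\<close> to \<open>y\<close>. By Kirchhoff's current law, the net current out of every vertex is the current
  injected there from outside: here one unit enters at \<open>i\<close> and leaves at \<open>j\<close>.
\<close>

definition unit_current_potential :: "'a pair_pre_digraph \<Rightarrow> 'a \<Rightarrow> 'a \<Rightarrow> ('a \<Rightarrow> real) \<Rightarrow> bool" where
  "unit_current_potential G i j \<phi> \<longleftrightarrow>
     (\<forall>x\<in>pverts G. (\<Sum>y\<in>neighbours G x. \<phi> x - \<phi> y) = of_bool (x = i) - of_bool (x = j))"

text \<open>
  On a connected graph such a potential exists and is unique up to an additive constant, so the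
  description below is proper.
\<close>

definition effective_resistance :: "'a pair_pre_digraph \<Rightarrow> 'a \<Rightarrow> 'a \<Rightarrow> real" where
  "effective_resistance G i j = (THE R. \<exists>\<phi>. unit_current_potential G i j \<phi> \<and> R = \<phi> i - \<phi> j)"

text \<open>
  The sum over ordered pairs counts every unordered pair twice, whence the factor; see
  \<open>kirchhoff_index_eq_sum_less\<close> for the form with \<open>i < j\<close>.
\<close>

definition kirchhoff_index :: "'a pair_pre_digraph \<Rightarrow> real" where
  "kirchhoff_index G =
     (\<Sum>(i, j)\<in>{(i, j). i \<in> pverts G \<and> j \<in> pverts G \<and> i \<noteq> j}. effective_resistance G i j) / 2"

lemma effective_resistance_commute: "effective_resistance G i j = effective_resistance G j i"
proof -
  have *: "\<exists>\<phi>. unit_current_potential G j i \<phi> \<and> R = \<phi> j - \<phi> i"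
    if "unit_current_potential G i j \<phi>" "R = \<phi> i - \<phi> j" for i j \<phi> R
  proof (intro exI[of _ "\<lambda>x. - \<phi> x"] conjI)
    have "(\<Sum>y\<in>neighbours G x. - \<phi> x - - \<phi> y) = - (\<Sum>y\<in>neighbours G x. \<phi> x - \<phi> y)" for x
      unfolding sum_negf[symmetric] by (intro sum.cong) auto
    then show "unit_current_potential G j i (\<lambda>x. - \<phi> x)"
      using that(1) unfolding unit_current_potential_def by simp
  qed (use that in simp)
  have "(\<exists>\<phi>. unit_current_potential G i j \<phi> \<and> R = \<phi> i - \<phi> j) \<longleftrightarrow>
        (\<exists>\<phi>. unit_current_potential G j i \<phi> \<and> R = \<phi> j - \<phi> i)" for R
    using * by blast
  then show ?thesis unfolding effective_resistance_def by simp
qed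

lemma kirchhoff_index_eq_sum_less:
  fixes v :: "nat \<Rightarrow> 'a"
  assumes v: "bij_betw v {..<n} (pverts G)"
  shows "kirchhoff_index G = (\<Sum>j<n. \<Sum>i<j. effective_resistance G (v i) (v j))"
proof -
  let ?R = "\<lambda>(i, j). effective_resistance G (v i) (v j)"
  let ?L = "{(i, j). i < j \<and> j < n}" and ?U = "{(i, j). j < i \<and> i < n}"
  have fin: "finite ?L" "finite ?U"
    by (rule finite_subset[of _ "{..<n} \<times> {..<n}"]; auto)+
  have inj: "inj_on v {..<n}" and img: "v ` {..<n} = pverts G"
    using v by (auto simp: bij_betw_def)
  have "bij_betw (map_prod v v) (?L \<union> ?U) {(i, j). i \<in> pverts G \<and> j \<in> pverts G \<and> i \<noteq> j}"
  proof (rule bij_betw_imageI)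
    show "inj_on (map_prod v v) (?L \<union> ?U)"
      by (rule inj_on_subset[OF map_prod_inj_on[OF inj inj]]) auto
    show "map_prod v v ` (?L \<union> ?U) = {(i, j). i \<in> pverts G \<and> j \<in> pverts G \<and> i \<noteq> j}"
    proof (intro set_eqI iffI)
      fix p assume "p \<in> map_prod v v ` (?L \<union> ?U)"
      then show "p \<in> {(i, j). i \<in> pverts G \<and> j \<in> pverts G \<and> i \<noteq> j}"
        using inj img by (fastforce simp: inj_on_def)
    next
      fix p assume "p \<in> {(i, j). i \<in> pverts G \<and> j \<in> pverts G \<and> i \<noteq> j}"
      then obtain i j where "p = (v i, v j)" "i < n" "j < n" "i \<noteq> j"
        unfolding img[symmetric] by auto
      then show "p \<in> map_prod v v ` (?L \<union> ?U)"
        by (intro image_eqI[of _ _ "(i, j)"]) auto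
    qed
  qed
  then have "2 * kirchhoff_index G = sum ?R (?L \<union> ?U)"
    unfolding kirchhoff_index_def
    by (simp add: sum.reindex_bij_betw[symmetric] case_prod_beta)
  also have "\<dots> = sum ?R ?L + sum ?R ?U"
    using fin by (intro sum.union_disjoint) auto
  also have "sum ?R ?U = sum ?R ?L"
    by (rule sum.reindex_bij_witness[of _ prod.swap prod.swap])
      (auto simp: effective_resistance_commute)
  also have "sum ?R ?L = (\<Sum>(j, i)\<in>(SIGMA j:{..<n}. {..<j}). effective_resistance G (v i) (v j))"
    by (rule sum.reindex_bij_witness[of _ prod.swap prod.swap]) auto
  also have "\<dots> = (\<Sum>j<n. \<Sum>i<j. effective_resistance G (v i) (v j))"
    by (simp add: sum.Sigma)
  finally show ?thesis by simp
qed


subsection \<open>Simple random walk and hitting times\<close>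

text \<open>
  The walk is driven by an i.i.d. sequence of random maps: at every time step, each vertex
  independently picks a uniform neighbour, and the walk moves to the pick of its current vertex.
  Lemma \<open>emeasure_walk\<close> confirms that this is the Markov chain with the transition probabilities of
  the simple random walk. (Only on the one-vertex graph is there a vertex without neighbours, and
  there the target is hit at time 0, so its expected hitting time is 0.)
\<close>

definition walk_space :: "'a pair_pre_digraph \<Rightarrow> ('a \<Rightarrow> 'a) stream measure" where
  "walk_space G = stream_space (\<Pi>\<^sub>M x\<in>pverts G. uniform_count_measure (neighbours G x))"

primrec walk :: "'a \<Rightarrow> ('a \<Rightarrow> 'a) stream \<Rightarrow> nat \<Rightarrow> 'a" where
  "walk a \<omega> 0 = a"
| "walk a \<omega> (Suc n) = (\<omega> !! n) (walk a \<omega> n)"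

text \<open>As an infimum in \<open>enat\<close>, the hitting time is \<open>\<infinity>\<close> if the target is never reached.\<close>

definition hitting_time :: "'a \<Rightarrow> (nat \<Rightarrow> 'a) \<Rightarrow> enat" where
  "hitting_time b X = Inf {enat n | n. X n = b}"

definition expected_hitting_time :: "'a pair_pre_digraph \<Rightarrow> 'a \<Rightarrow> 'a \<Rightarrow> ennreal" where
  "expected_hitting_time G a b =
     (\<integral>\<^sup>+ \<omega>. ennreal_of_enat (hitting_time b (walk a \<omega>)) \<partial>walk_space G)"

definition highly_symmetric :: "'a pair_pre_digraph \<Rightarrow> bool" where
  "highly_symmetric G \<longleftrightarrow>
     (\<forall>a\<in>pverts G. \<forall>b\<in>pverts G. expected_hitting_time G a b = expected_hitting_time G b a)"

context
  fixes G :: "'a pair_pre_digraph"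
  assumes G: "pair_graph G" and nbrs: "\<And>x. x \<in> pverts G \<Longrightarrow> neighbours G x \<noteq> {}"
begin

interpretation pair_graph G by (rule G)

private abbreviation "steps \<equiv> \<Pi>\<^sub>M x\<in>pverts G. uniform_count_measure (neighbours G x)"

lemma neighbours_in_verts: "neighbours G x \<subseteq> pverts G"
  by (auto simp: neighbours_def dest: in_arcsD2)

lemma finite_neighbours: "finite (neighbours G x)"
  using neighbours_in_verts pair_finite_verts by (rule finite_subset)

lemma prob_space_step: "x \<in> pverts G \<Longrightarrow> prob_space (uniform_count_measure (neighbours G x))"
  using finite_neighbours nbrs by (intro prob_space_uniform_count_measure)

lemma prob_space_steps: "prob_space steps"
  by (intro prob_space_PiM prob_space_step)

lemma prob_space_walk_space: "prob_space (walk_space G)"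
  unfolding walk_space_def by (intro prob_space.prob_space_stream_space prob_space_steps)

lemma measurable_walk:
  assumes "a \<in> pverts G"
  shows "(\<lambda>\<omega>. walk a \<omega> n) \<in> walk_space G \<rightarrow>\<^sub>M count_space (pverts G)"
proof (induction n)
  case 0
  then show ?case using assms by simp
next
  case (Suc n)
  have "(\<lambda>\<omega>. (\<omega> !! n) x) \<in> walk_space G \<rightarrow>\<^sub>M count_space (pverts G)" if "x \<in> pverts G" for x
  proof -
    have "(\<lambda>f. f x) \<in> steps \<rightarrow>\<^sub>M uniform_count_measure (neighbours G x)"
      using that by (rule measurable_component_singleton)
    moreover have "id \<in> uniform_count_measure (neighbours G x) \<rightarrow>\<^sub>M count_space (pverts G)"
      using neighbours_in_verts[of x]
      by (auto simp: measurable_def space_uniform_count_measure sets_uniform_count_measure)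
    ultimately show ?thesis
      unfolding walk_space_def
      by (auto intro: measurable_compose[OF measurable_compose[OF measurable_snth]] simp: id_def)
  qed
  then show ?case
    using measurable_compose_countable'[OF _ Suc countable_finite[OF pair_finite_verts],
      of "\<lambda>x \<omega>. (\<omega> !! n) x"] by simp
qed

lemma walk_Stream_Suc: "walk a (f ## \<omega>) (Suc n) = walk (f a) \<omega> n"
  by (induction n) auto

lemma emeasure_walk:
  assumes "a \<in> pverts G"
  shows "emeasure (walk_space G) {\<omega>\<in>space (walk_space G). \<forall>i\<le>n. walk a \<omega> i = p i} =
    ennreal (of_bool (p 0 = a) *
      (\<Prod>i<n. of_bool ((p i, p (Suc i)) \<in> parcs G) / card (neighbours G (p i))))"
  using assms
proof (induction n arbitrary: a p)
  case 0
  show ?case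
  proof (cases "p 0 = a")
    case True
    then show ?thesis
      using prob_space.emeasure_space_1[OF prob_space_walk_space] by simp
  next
    case False
    then have "{\<omega>\<in>space (walk_space G). \<forall>i\<le>0. walk a \<omega> i = p i} = {}" by auto
    with False show ?thesis by (simp only: emeasure_empty) simp
  qed
next
  case (Suc n)
  let ?W = "walk_space G"
  let ?N = "neighbours G a"
  define A where "A = (\<lambda>n a p. {\<omega>\<in>space ?W. \<forall>i\<le>n. walk a \<omega> i = p i})"
  let ?P = "\<Prod>i<n. of_bool ((p (Suc i), p (Suc (Suc i))) \<in> parcs G) /
    real (card (neighbours G (p (Suc i))))"
  have meas: "A n a p \<in> sets ?W" if "a \<in> pverts G" for n a p
  proof -
    have "(\<lambda>\<omega>. walk a \<omega> i) -` ({p i} \<inter> pverts G) \<inter> space ?W \<in> sets ?W" for i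
      by (rule measurable_sets[OF measurable_walk[OF that]]) auto
    moreover have "(\<lambda>\<omega>. walk a \<omega> i) -` ({p i} \<inter> pverts G) \<inter> space ?W =
        {\<omega>\<in>space ?W. walk a \<omega> i = p i}" for i
      using measurable_space[OF measurable_walk[OF that]] by auto
    ultimately have *: "{\<omega>\<in>space ?W. walk a \<omega> i = p i} \<in> sets ?W" for i by simp
    have "{\<omega>\<in>space ?W. \<forall>i\<in>{..n}. walk a \<omega> i = p i} \<in> sets ?W"
      by (rule sets.sets_Collect_finite_All[where P = "\<lambda>i \<omega>. walk a \<omega> i = p i", OF * finite_atMost])
    then show ?thesis by (simp only: A_def Ball_def atMost_iff)
  qed
  have space: "f ## \<omega> \<in> space ?W \<longleftrightarrow> \<omega> \<in> space ?W" if "f \<in> space steps" for f \<omega>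
    using that by (auto simp: walk_space_def space_stream_space streams_Stream)
  have all_Suc: "(\<forall>i\<le>Suc n. Q i) \<longleftrightarrow> Q 0 \<and> (\<forall>i\<le>n. Q (Suc i))" for Q
    by (metis Suc_le_mono le0 not0_implies_Suc)
  have rec: "f ## \<omega> \<in> A (Suc n) a p \<longleftrightarrow> p 0 = a \<and> \<omega> \<in> A n (f a) (p \<circ> Suc)"
    if "f \<in> space steps" for f \<omega>
    unfolding A_def mem_Collect_eq all_Suc walk_Stream_Suc space[OF that] by auto
  have step_in: "f a \<in> ?N" if "f \<in> space steps" for f
    using that Suc.prems by (auto simp: space_PiM space_uniform_count_measure)
  have "emeasure ?W (A (Suc n) a p) = (\<integral>\<^sup>+\<omega>. indicator (A (Suc n) a p) \<omega> \<partial>?W)"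
    by (rule nn_integral_indicator[OF meas[OF Suc.prems], symmetric])
  also have "\<dots> = (\<integral>\<^sup>+f. \<integral>\<^sup>+\<omega>. indicator (A (Suc n) a p) (f ## \<omega>) \<partial>?W \<partial>steps)"
    using meas[OF Suc.prems, of "Suc n" p] unfolding walk_space_def
    by (intro prob_space.nn_integral_stream_space[OF prob_space_steps] borel_measurable_indicator)
  also have "\<dots> = (\<integral>\<^sup>+f. of_bool (p 0 = a) * emeasure ?W (A n (f a) (p \<circ> Suc)) \<partial>steps)"
  proof (intro nn_integral_cong)
    fix f assume f: "f \<in> space steps"
    then have fa: "f a \<in> pverts G" using step_in neighbours_in_verts by blast
    have "(\<integral>\<^sup>+\<omega>. indicator (A (Suc n) a p) (f ## \<omega>) \<partial>?W) =
       (\<integral>\<^sup>+\<omega>. of_bool (p 0 = a) * indicator (A n (f a) (p \<circ> Suc)) \<omega> \<partial>?W)"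
      using rec[OF f] by (intro nn_integral_cong) (simp add: indicator_def)
    also have "\<dots> = of_bool (p 0 = a) * emeasure ?W (A n (f a) (p \<circ> Suc))"
      using meas[OF fa] by (simp add: nn_integral_cmult)
    finally show "(\<integral>\<^sup>+\<omega>. indicator (A (Suc n) a p) (f ## \<omega>) \<partial>?W) = \<dots>" .
  qed
  also have "\<dots> = (\<integral>\<^sup>+x. of_bool (p 0 = a) * emeasure ?W (A n x (p \<circ> Suc))
      \<partial>uniform_count_measure ?N)"
  proof -
    have coord: "(\<lambda>f. f a) \<in> steps \<rightarrow>\<^sub>M uniform_count_measure ?N"
      using Suc.prems by (rule measurable_component_singleton)
    have "distr steps (uniform_count_measure ?N) (\<lambda>f. f a) = uniform_count_measure ?N"
      by (rule distr_PiM_component[OF prob_space_step Suc.prems])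
    from arg_cong[OF this, of "\<lambda>N. \<integral>\<^sup>+x. of_bool (p 0 = a) * emeasure ?W (A n x (p \<circ> Suc)) \<partial>N"]
    show ?thesis
      by (subst (asm) nn_integral_distr[OF coord])
        (auto simp: measurable_def space_uniform_count_measure sets_uniform_count_measure)
  qed
  also have "\<dots> = (\<Sum>x\<in>?N. ennreal (1 / card ?N) *
      (of_bool (p 0 = a) * emeasure ?W (A n x (p \<circ> Suc))))"
    unfolding uniform_count_measure_def
    using finite_neighbours by (simp add: nn_integral_point_measure_finite mult_ac)
  also have "\<dots> = (\<Sum>x\<in>?N. ennreal (1 / card ?N * (of_bool (p 0 = a) * (of_bool (p 1 = x) * ?P))))"
  proof (intro sum.cong refl)
    fix x assume "x \<in> ?N"
    then have "x \<in> pverts G" using neighbours_in_verts by blast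
    from Suc.IH[OF this, of "p \<circ> Suc"]
    have "emeasure ?W (A n x (p \<circ> Suc)) = ennreal (of_bool (p 1 = x) * ?P)"
      unfolding A_def by (simp only: o_apply One_nat_def)
    then have "ennreal (1 / card ?N) * (of_bool (p 0 = a) * emeasure ?W (A n x (p \<circ> Suc))) =
        ennreal (1 / card ?N) * (ennreal (of_bool (p 0 = a)) * ennreal (of_bool (p 1 = x) * ?P))"
      by (cases "p 0 = a") simp_all
    also have "\<dots> = ennreal (1 / card ?N * (of_bool (p 0 = a) * (of_bool (p 1 = x) * ?P)))"
      by (simp only: ennreal_mult'[symmetric] zero_le_divide_1_iff of_nat_0_le_iff zero_less_eq_of_bool)
    finally show "ennreal (1 / card ?N) * (of_bool (p 0 = a) * emeasure ?W (A n x (p \<circ> Suc))) =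
        ennreal (1 / card ?N * (of_bool (p 0 = a) * (of_bool (p 1 = x) * ?P)))"
      .
  qed
  also have "\<dots> = ennreal (\<Sum>x\<in>?N. 1 / card ?N * (of_bool (p 0 = a) * (of_bool (p 1 = x) * ?P)))"
    by (intro sum_ennreal) (auto intro!: prod_nonneg mult_nonneg_nonneg divide_nonneg_nonneg)
  also have "(\<Sum>x\<in>?N. 1 / card ?N * (of_bool (p 0 = a) * (of_bool (p 1 = x) * ?P))) =
      (\<Sum>x\<in>?N. if p 1 = x then 1 / card ?N * (of_bool (p 0 = a) * ?P) else 0)"
    by (intro sum.cong) auto
  also have "\<dots> = (if p 1 \<in> ?N then 1 / card ?N * (of_bool (p 0 = a) * ?P) else 0)"
    using finite_neighbours by (simp add: sum.delta')
  also have "\<dots> = of_bool (p 0 = a) *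
      (\<Prod>i<Suc n. of_bool ((p i, p (Suc i)) \<in> parcs G) / card (neighbours G (p i)))"
    unfolding prod.lessThan_Suc_shift by (auto simp: neighbours_def)
  finally show ?case unfolding A_def .
qed

end


subsection \<open>Clusters\<close>

text \<open>
  The vertex \<open>(v, x)\<close> is the vertex \<open>x\<close> of the copy of \<open>G2\<close> associated with \<open>v\<close>. The copy \<open>(v, r)\<close>
  of the root is identified with the vertex \<open>v\<close> of \<open>G1\<close>, so it carries the edges of \<open>v\<close> in \<open>G1\<close>.
\<close>

definition cluster ::
  "'a pair_pre_digraph \<Rightarrow> 'b pair_pre_digraph \<Rightarrow> 'b \<Rightarrow> ('a \<times> 'b) pair_pre_digraph" where
  "cluster G1 G2 r = \<lparr>
     pverts = pverts G1 \<times> pverts G2,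
     parcs = {((v, r), (w, r)) | v w. (v, w) \<in> parcs G1} \<union>
             {((v, x), (v, y)) | v x y. v \<in> pverts G1 \<and> (x, y) \<in> parcs G2} \<rparr>"

lemma connected_graph_cluster:
  assumes G1: "connected_graph G1" and G2: "connected_graph G2" and r: "r \<in> pverts G2"
  shows "connected_graph (cluster G1 G2 r)"
proof -
  interpret G1: pair_graph G1 using G1 by (simp add: connected_graph_def)
  interpret G2: pair_graph G2 using G2 by (simp add: connected_graph_def)
  let ?C = "cluster G1 G2 r"
  have sub: "parcs ?C \<subseteq> pverts ?C \<times> pverts ?C"
    using r by (auto simp: cluster_def dest: G1.in_arcsD1 G1.in_arcsD2 G2.in_arcsD1 G2.in_arcsD2)
  have fin: "finite (pverts ?C)"
    using G1.pair_finite_verts G2.pair_finite_verts by (simp add: cluster_def)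
  interpret C: pair_graph ?C
  proof
    show "finite (parcs ?C)" using sub fin by (meson finite_SigmaI finite_subset)
    show "symmetric (with_proj ?C)"
      unfolding symmetric_def
      by (auto intro!: symI simp: cluster_def dest: G1.arcs_symmetric G2.arcs_symmetric)
    show "fst e \<noteq> snd e" if "e \<in> parcs ?C" for e
      using that by (auto simp: cluster_def dest: G1.no_loops' G2.no_loops')
  qed (use sub fin in auto)
  have reach: "x \<rightarrow>\<^sup>*\<^bsub>with_proj G\<^esub> y"
    if "connected_graph G" "x \<in> pverts G" "y \<in> pverts G" for G :: "'c pair_pre_digraph" and x y
  proof -
    interpret pair_graph G using that(1) by (simp add: connected_graph_def)
    have "x \<rightarrow>\<^sup>*\<^bsub>with_proj (mk_symmetric (with_proj G))\<^esub> y"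
      using that by (simp add: connected_graph_def connected_def strongly_connected_def)
    then show ?thesis by (simp only: reachable_mk_symmetric_eq[OF sym_arcs])
  qed
  have adj: "u \<rightarrow>\<^sup>*\<^bsub>with_proj ?C\<^esub> w" if "(u, w) \<in> parcs ?C" for u w
    using that by (intro C.reachable_adjI) simp
  have base: "(v, r) \<rightarrow>\<^sup>*\<^bsub>with_proj ?C\<^esub> (w, r)" if "v \<rightarrow>\<^sup>*\<^bsub>with_proj G1\<^esub> w" for v w
    using that
  proof (induction rule: G1.reachable_induct)
    case base
    then show ?case using r by (intro C.reachable_refl) (simp add: cluster_def)
  next
    case (step x y)
    then show ?case
      by (elim C.reachable_trans) (rule adj, simp add: cluster_def)
  qed
  have fibre: "(v, x) \<rightarrow>\<^sup>*\<^bsub>with_proj ?C\<^esub> (v, y)" if "x \<rightarrow>\<^sup>*\<^bsub>with_proj G2\<^esub> y" "v \<in> pverts G1" for v x y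
    using that(1)
  proof (induction rule: G2.reachable_induct)
    case base
    then show ?case using that(2) by (intro C.reachable_refl) (simp add: cluster_def)
  next
    case (step x y)
    then show ?case using that(2)
      by (elim C.reachable_trans) (rule adj, simp add: cluster_def)
  qed
  have "Digraph_Component.connected (with_proj ?C)"
    unfolding connected_def strongly_connected_def
  proof (intro conjI ballI)
    show "verts (with_proj (mk_symmetric (with_proj ?C))) \<noteq> {}"
      using G1 r by (auto simp: cluster_def connected_graph_def connected_def strongly_connected_def)
    fix u w assume "u \<in> verts (with_proj (mk_symmetric (with_proj ?C)))"
      "w \<in> verts (with_proj (mk_symmetric (with_proj ?C)))"
    then obtain v x v' x' where
      *: "u = (v, x)" "w = (v', x')" "v \<in> pverts G1" "v' \<in> pverts G1" "x \<in> pverts G2" "x' \<in> pverts G2"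
      by (auto simp: cluster_def)
    then have "(v, x) \<rightarrow>\<^sup>*\<^bsub>with_proj ?C\<^esub> (v, r)" "(v, r) \<rightarrow>\<^sup>*\<^bsub>with_proj ?C\<^esub> (v', r)"
      "(v', r) \<rightarrow>\<^sup>*\<^bsub>with_proj ?C\<^esub> (v', x')"
      using r G1 G2 by (auto intro!: fibre base reach)
    then have "u \<rightarrow>\<^sup>*\<^bsub>with_proj ?C\<^esub> w"
      unfolding * by (meson C.reachable_trans)
    then show "u \<rightarrow>\<^sup>*\<^bsub>with_proj (mk_symmetric (with_proj ?C))\<^esub> w"
      by (rule C.reachable_mk_symmetricI)
  qed
  then show ?thesis
    by (simp add: connected_graph_def C.pair_graph)
qed

end

theory Submission
  imports Defs
begin

text \<open>
  A current between two different copies of \<open>G2\<close> in the cluster leaves its copy through the root,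
  crosses \<open>G1\<close>, and enters the other copy through the root: three resistors in series. Within
  one copy it never leaves the copy. Summing over all pairs of vertices
  (\<open>kirchhoff_index_cluster\<close>) gives, for every connected \<open>G2\<close>,
  \<open>R(G) = n2\<^sup>2 R(G1) + n1 R(G2) + n1 (n1 - 1) n2 S(r)\<close> with
  \<open>S(r) = \<Sum>\<^sub>x R\<^sub>x\<^sub>r\<close>, the sum over the vertices of \<open>G2\<close>.
  Since \<open>\<Sum>\<^sub>r S(r) = 2 R(G2)\<close>, the claim amounts to \<open>S(r)\<close> being independent of \<open>r\<close>.

  This is where regularity and high symmetry enter, through the Laplacian of the mean hitting times:
  as a function of the starting vertex, the mean hitting time of \<open>b\<close> has Laplacian
  \<open>deg - vol \<delta>\<^sub>b\<close>, where \<open>vol\<close> is the sum of all degrees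
  (\<open>laplacian_mean_hitting_time\<close>). Hence differences of mean hitting times are potentials, which
  yields both the existence of effective resistances and the commute time identity
  \<open>vol R\<^sub>a\<^sub>b = E\<^sub>a T\<^sub>b + E\<^sub>b T\<^sub>a\<close>. High symmetry turns the right-hand side into
  \<open>2 E\<^sub>r T\<^sub>x\<close> for \<open>a = x\<close>, \<open>b = r\<close>. Finally \<open>\<Sum>\<^sub>x deg(x) E\<^sub>r T\<^sub>x\<close> is harmonic in \<open>r\<close>, because
  the contributions to its Laplacian cancel, and so it is constant (\<open>random_target\<close>); in a regular
  graph the weights drop out, and \<open>S(r)\<close> is constant.

  The mean hitting times are handled as real series of survival probabilities, defined by the
  first-step recursion; geometric decay of these makes them finite. They are
  matched with the expectations on the path space in \<open>expected_hitting_time_eq\<close>.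
\<close>

section \<open>The Laplacian of a connected graph\<close>

definition laplacian :: "'a pair_pre_digraph \<Rightarrow> ('a \<Rightarrow> real) \<Rightarrow> 'a \<Rightarrow> real" where
  "laplacian G \<phi> x = (\<Sum>y\<in>neighbours G x. \<phi> x - \<phi> y)"

lemma unit_current_potential_iff_laplacian:
  "unit_current_potential G i j \<phi> \<longleftrightarrow>
    (\<forall>x\<in>pverts G. laplacian G \<phi> x = of_bool (x = i) - of_bool (x = j))"
  by (simp add: unit_current_potential_def laplacian_def)

lemma laplacian_const [simp]: "laplacian G (\<lambda>x. c) x = 0"
  by (simp add: laplacian_def)

lemma laplacian_add: "laplacian G (\<lambda>x. \<phi> x + \<psi> x) x = laplacian G \<phi> x + laplacian G \<psi> x"
  by (simp add: laplacian_def sum.distrib[symmetric] algebra_simps)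

lemma laplacian_diff: "laplacian G (\<lambda>x. \<phi> x - \<psi> x) x = laplacian G \<phi> x - laplacian G \<psi> x"
  by (simp add: laplacian_def sum_subtractf[symmetric] algebra_simps)

lemma laplacian_cmult: "laplacian G (\<lambda>x. c * \<phi> x) x = c * laplacian G \<phi> x"
  by (simp add: laplacian_def sum_distrib_left algebra_simps)

lemma laplacian_divide: "laplacian G (\<lambda>x. \<phi> x / c) x = laplacian G \<phi> x / c"
  using laplacian_cmult[of G "1 / c" \<phi> x] by simp

lemma laplacian_sum: "laplacian G (\<lambda>x. \<Sum>i\<in>I. \<phi> i x) x = (\<Sum>i\<in>I. laplacian G (\<phi> i) x)"
  unfolding laplacian_def sum_subtractf[symmetric] by (rule sum.swap)

lemma connected_graph_pair_graph: "connected_graph G \<Longrightarrow> pair_graph G"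
  by (simp add: connected_graph_def)

lemma connected_graph_finite: "connected_graph G \<Longrightarrow> finite (pverts G)"
  by (meson connected_graph_pair_graph pair_digraph.axioms(1) pair_fin_digraph.pair_finite_verts
      pair_graph.axioms(1))

lemma neighbours_subset: "pair_graph G \<Longrightarrow> neighbours G x \<subseteq> pverts G"
proof -
  assume "pair_graph G"
  then interpret pair_graph G .
  show ?thesis by (auto simp: neighbours_def dest: in_arcsD2)
qed

lemma neighbours_finite:
  assumes "pair_graph G"
  shows "finite (neighbours G x)"
proof -
  interpret pair_graph G by fact
  show ?thesis using neighbours_subset[OF assms] pair_finite_verts by (rule finite_subset)
qed

lemma neighbours_sym:
  assumes "pair_graph G"
  shows "y \<in> neighbours G x \<longleftrightarrow> x \<in> neighbours G y"
proof -
  interpret pair_graph G by fact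
  show ?thesis by (auto simp: neighbours_def dest: arcs_symmetric)
qed

text \<open>
  Connectedness in the form in which it is used: a property that spreads along edges and holds at
  one vertex holds everywhere.
\<close>

lemma connected_graph_induct [consumes 3, case_names base step]:
  assumes G: "connected_graph G" and a: "a \<in> pverts G" and b: "b \<in> pverts G"
    and base: "P b"
    and step: "\<And>x y. x \<in> pverts G \<Longrightarrow> y \<in> neighbours G x \<Longrightarrow> P x \<Longrightarrow> P y"
  shows "P a"
proof -
  interpret pair_graph G by (rule connected_graph_pair_graph[OF G])
  have "strongly_connected (with_proj G)"
    using G symmetric_connected_imp_strongly_connected[OF sym_arcs]
    by (simp add: connected_graph_def)
  then have "b \<rightarrow>\<^sup>*\<^bsub>with_proj G\<^esub> a" using a b by (simp add: strongly_connected_def)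
  then show ?thesis
  proof (induction rule: reachable_induct)
    case base
    show ?case by fact
  next
    case (step x y)
    then show ?case using assms(5)[of x y] by (auto simp: neighbours_def dest: in_arcsD1)
  qed
qed

lemma neighbours_nonempty:
  assumes G: "connected_graph G" and ab: "a \<in> pverts G" "b \<in> pverts G" "a \<noteq> b"
    and x: "x \<in> pverts G"
  shows "neighbours G x \<noteq> {}"
proof
  assume *: "neighbours G x = {}"
  have "y = x" if "y \<in> pverts G" for y
    using G that x
  proof (induction rule: connected_graph_induct)
    case (step z y)
    then show ?case using * by simp
  qed simp
  then show False using ab by metis
qed

text \<open>Every arc contributes the negative of what the reversed arc contributes.\<close>

lemma sum_laplacian:
  assumes "pair_graph G"
  shows "(\<Sum>x\<in>pverts G. laplacian G \<phi> x) = 0"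
proof -
  interpret pair_graph G by fact
  let ?V = "pverts G"
  let ?f = "\<lambda>x y. of_bool (y \<in> neighbours G x) * (\<phi> x - \<phi> y)"
  have "(\<Sum>x\<in>?V. laplacian G \<phi> x) = (\<Sum>x\<in>?V. \<Sum>y\<in>?V. ?f x y)"
    unfolding laplacian_def using neighbours_subset[OF assms] pair_finite_verts
    by (intro sum.cong refl sum.mono_neutral_cong_left) auto
  moreover have "(\<Sum>x\<in>?V. \<Sum>y\<in>?V. ?f x y) = (\<Sum>y\<in>?V. \<Sum>x\<in>?V. ?f x y)"
    by (rule sum.swap)
  moreover have "(\<Sum>y\<in>?V. \<Sum>x\<in>?V. ?f x y) = (\<Sum>y\<in>?V. \<Sum>x\<in>?V. - ?f y x)"
    by (intro sum.cong refl) (auto simp: neighbours_sym[OF assms])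
  ultimately show ?thesis by (simp add: sum_negf)
qed

text \<open>The maximum principle: a maximum of a harmonic function spreads to the neighbours.\<close>

lemma harmonic_constant:
  assumes G: "connected_graph G" and harm: "\<And>x. x \<in> pverts G \<Longrightarrow> laplacian G \<phi> x = 0"
    and ab: "a \<in> pverts G" "b \<in> pverts G"
  shows "\<phi> a = \<phi> b"
proof -
  note pg = connected_graph_pair_graph[OF G]
  note fin = connected_graph_finite[OF G]
  define m where "m = Max (\<phi> ` pverts G)"
  have le: "\<phi> x \<le> m" if "x \<in> pverts G" for x
    using that fin by (simp add: m_def)
  have "m \<in> \<phi> ` pverts G" unfolding m_def using fin ab by (intro Max_in) auto
  then obtain c where c: "c \<in> pverts G" "\<phi> c = m" by auto
  have "\<phi> x = m" if "x \<in> pverts G" for x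
    using G that c(1)
  proof (induction rule: connected_graph_induct)
    case base
    show ?case by fact
  next
    case (step x y)
    have "\<forall>z\<in>neighbours G x. \<phi> x - \<phi> z = 0"
      using harm[OF step(1)] neighbours_subset[OF pg, of x] le step(3)
      unfolding laplacian_def
      by (subst (asm) sum_nonneg_eq_0_iff[OF neighbours_finite[OF pg]]) auto
    then show ?case using step by auto
  qed
  then show ?thesis using ab by simp
qed

text \<open>
  The defining description of the effective resistance is unambiguous: two potentials for the same
  current differ by a harmonic function, hence by a constant.
\<close>

lemma effective_resistance_eq:
  assumes G: "connected_graph G" and ij: "i \<in> pverts G" "j \<in> pverts G"
    and \<phi>: "unit_current_potential G i j \<phi>"
  shows "effective_resistance G i j = \<phi> i - \<phi> j"
  unfolding effective_resistance_def
proof (rule the_equality)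
  show "\<exists>\<psi>. unit_current_potential G i j \<psi> \<and> \<phi> i - \<phi> j = \<psi> i - \<psi> j" using \<phi> by blast
next
  fix R assume "\<exists>\<psi>. unit_current_potential G i j \<psi> \<and> R = \<psi> i - \<psi> j"
  then obtain \<psi> where \<psi>: "unit_current_potential G i j \<psi>" "R = \<psi> i - \<psi> j" by blast
  have "\<psi> i - \<phi> i = \<psi> j - \<phi> j"
    by (rule harmonic_constant[where \<phi> = "\<lambda>x. \<psi> x - \<phi> x", OF G _ ij])
      (use \<phi> \<psi> in \<open>simp add: laplacian_diff unit_current_potential_iff_laplacian\<close>)
  then show "R = \<phi> i - \<phi> j" using \<psi>(2) by simp
qed

lemma effective_resistance_self:
  assumes "connected_graph G" "i \<in> pverts G"
  shows "effective_resistance G i i = 0"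
  using effective_resistance_eq[OF assms(1,2,2), of "\<lambda>x. 0"]
  by (simp add: unit_current_potential_iff_laplacian)

lemma kirchhoff_index_eq_double_sum:
  assumes "connected_graph G"
  shows "2 * kirchhoff_index G = (\<Sum>i\<in>pverts G. \<Sum>j\<in>pverts G. effective_resistance G i j)"
proof -
  have "2 * kirchhoff_index G = (\<Sum>(i, j)\<in>pverts G \<times> pverts G. effective_resistance G i j)"
    unfolding kirchhoff_index_def
    using connected_graph_finite[OF assms] effective_resistance_self[OF assms]
    by (simp, intro sum.mono_neutral_left) auto
  then show ?thesis by (simp add: sum.cartesian_product)
qed


section \<open>Mean hitting times\<close>

text \<open>
  \<open>survival G b n a\<close> is the probability that the walk started at \<open>a\<close> avoids \<open>b\<close> at all times
  \<open>0, \<dots>, n\<close>, given by conditioning on the first step. Summed over \<open>n\<close> these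
  probabilities give the expectation of the hitting time of \<open>b\<close>.
\<close>

primrec survival :: "'a pair_pre_digraph \<Rightarrow> 'a \<Rightarrow> nat \<Rightarrow> 'a \<Rightarrow> real" where
  "survival G b 0 a = of_bool (a \<noteq> b)"
| "survival G b (Suc n) a =
    of_bool (a \<noteq> b) * ((\<Sum>y\<in>neighbours G a. survival G b n y) / card (neighbours G a))"

definition mean_hitting_time :: "'a pair_pre_digraph \<Rightarrow> 'a \<Rightarrow> 'a \<Rightarrow> real" where
  "mean_hitting_time G b a = (\<Sum>n. survival G b n a)"

lemma survival_nonneg: "0 \<le> survival G b n a"
proof (induction n arbitrary: a)
  case (Suc n)
  have "0 \<le> (\<Sum>y\<in>neighbours G a. survival G b n y)" by (intro sum_nonneg Suc)
  then show ?case by simp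
qed simp

lemma survival_target [simp]: "survival G b n b = 0"
  by (cases n) auto

lemma survival_le_1: "survival G b n a \<le> 1"
proof (induction n arbitrary: a)
  case (Suc n)
  have "(\<Sum>y\<in>neighbours G a. survival G b n y) \<le> of_nat (card (neighbours G a)) * 1"
    by (intro sum_bounded_above Suc)
  then show ?case by (auto simp: divide_le_eq_1)
qed simp

lemma survival_decseq: "decseq (\<lambda>n. survival G b n a)"
proof (rule decseq_SucI)
  show "survival G b (Suc n) a \<le> survival G b n a" for n
  proof (induction n arbitrary: a)
    case 0
    show ?case using survival_le_1[of G b "Suc 0" a] by (cases "a = b") auto
  next
    case (Suc n)
    have "(\<Sum>y\<in>neighbours G a. survival G b (Suc n) y) \<le> (\<Sum>y\<in>neighbours G a. survival G b n y)"
      by (intro sum_mono Suc)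
    then show ?case
      unfolding survival.simps(2)[of G b "Suc n"] survival.simps(2)[of G b n a]
      by (intro mult_left_mono divide_right_mono) auto
  qed
qed

text \<open>A vertex with a neighbour that can reach the target can reach the target one step later.\<close>

lemma survival_less_1:
  assumes G: "connected_graph G" and "a \<in> pverts G" "b \<in> pverts G"
  shows "\<exists>n. survival G b n a < 1"
  using assms
proof (induction rule: connected_graph_induct)
  case base
  show ?case by simp
next
  case (step x y)
  note pg = connected_graph_pair_graph[OF G]
  from step(3) obtain n where n: "survival G b n x < 1" by blast
  have x: "x \<in> neighbours G y" using step(2) neighbours_sym[OF pg] by blast
  have "(\<Sum>z\<in>neighbours G y. survival G b n z) < (\<Sum>z\<in>neighbours G y. 1)"
    using x n survival_le_1 by (intro sum_strict_mono_ex1 neighbours_finite[OF pg]) auto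
  then have "survival G b (Suc n) y < 1"
    by (auto simp: divide_less_eq_1)
  then show ?case by blast
qed

text \<open>
  From every vertex the target is hit within a bounded time with probability bounded away from 0,
  so the survival probabilities decay geometrically.
\<close>

lemma survival_summable:
  assumes G: "connected_graph G" and a: "a \<in> pverts G" and b: "b \<in> pverts G"
  shows "summable (\<lambda>n. survival G b n a)"
proof -
  note pg = connected_graph_pair_graph[OF G]
  note fin = connected_graph_finite[OF G]
  obtain t where t: "\<And>x. x \<in> pverts G \<Longrightarrow> survival G b (t x) x < 1"
    using survival_less_1[OF G _ b] by metis
  define N where "N = Max (t ` pverts G)"
  define \<rho> where "\<rho> = Max ((\<lambda>x. survival G b N x) ` pverts G)"
  have "survival G b N x < 1" if "x \<in> pverts G" for x
  proof -
    have "t x \<le> N" using that fin by (simp add: N_def)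
    then have "survival G b N x \<le> survival G b (t x) x"
      using survival_decseq by (rule decseqD[rotated])
    with t[OF that] show ?thesis by simp
  qed
  then have \<rho>: "\<rho> < 1" unfolding \<rho>_def using fin b by (subst Max_less_iff) auto
  have le_\<rho>: "survival G b N x \<le> \<rho>" if "x \<in> pverts G" for x
    unfolding \<rho>_def using that fin by simp
  have decay: "survival G b (N + n) x \<le> \<rho> * survival G b n x" if "x \<in> pverts G" for n x
    using that
  proof (induction n arbitrary: x)
    case 0
    then show ?case using le_\<rho> by (cases "x = b") auto
  next
    case (Suc n)
    have "(\<Sum>y\<in>neighbours G x. survival G b (N + n) y) \<le>
        (\<Sum>y\<in>neighbours G x. \<rho> * survival G b n y)"
      using neighbours_subset[OF pg] by (intro sum_mono Suc) auto
    then have "(\<Sum>y\<in>neighbours G x. survival G b (N + n) y) / card (neighbours G x) \<le>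
        \<rho> * (\<Sum>y\<in>neighbours G x. survival G b n y) / card (neighbours G x)"
      by (intro divide_right_mono) (auto simp: sum_distrib_left)
    then show ?case by (cases "x = b") auto
  qed
  show ?thesis
  proof (rule summableI_nonneg_bounded)
    show "0 \<le> survival G b n a" for n by (rule survival_nonneg)
    fix n
    let ?S = "\<Sum>k<n. survival G b k a"
    have "?S \<le> (\<Sum>k<N + n. survival G b k a)"
      by (intro sum_mono2) (auto intro: survival_nonneg)
    also have "\<dots> = (\<Sum>k<N. survival G b k a) + (\<Sum>k<n. survival G b (N + k) a)"
      by (induction n) simp_all
    also have "\<dots> \<le> of_nat (card {..<N}) * 1 + (\<Sum>k<n. \<rho> * survival G b k a)"
      by (intro add_mono sum_bounded_above sum_mono decay a survival_le_1)
    also have "\<dots> = N + \<rho> * ?S" by (simp add: sum_distrib_left)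
    \<comment> \<open>Shifting the series by \<open>N\<close> bounds each partial sum in terms of itself.\<close>
    finally have "?S * (1 - \<rho>) \<le> N" by (simp add: algebra_simps)
    then show "?S \<le> N / (1 - \<rho>)" using \<rho> by (simp add: pos_le_divide_eq)
  qed
qed

lemma mean_hitting_time_target [simp]: "mean_hitting_time G b b = 0"
  by (simp add: mean_hitting_time_def)

lemma mean_hitting_time_nonneg:
  assumes "connected_graph G" "a \<in> pverts G" "b \<in> pverts G"
  shows "0 \<le> mean_hitting_time G b a"
  unfolding mean_hitting_time_def
  using survival_summable[OF assms] survival_nonneg by (rule suminf_nonneg)

lemma mean_hitting_time_step:
  assumes G: "connected_graph G" and a: "a \<in> pverts G" and b: "b \<in> pverts G" and "a \<noteq> b"
  shows "mean_hitting_time G b a =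
    1 + (\<Sum>y\<in>neighbours G a. mean_hitting_time G b y) / card (neighbours G a)"
proof -
  have sums: "(\<lambda>n. survival G b n y) sums mean_hitting_time G b y" if "y \<in> pverts G" for y
    unfolding mean_hitting_time_def by (intro summable_sums survival_summable G that b)
  have "(\<lambda>n. survival G b (Suc n) a) sums
      ((\<Sum>y\<in>neighbours G a. mean_hitting_time G b y) / card (neighbours G a))"
    using \<open>a \<noteq> b\<close> neighbours_subset[OF connected_graph_pair_graph[OF G]]
    by (auto intro!: sums_divide sums_sum sums)
  from sums_Suc[OF this] sums[OF a] show ?thesis
    using \<open>a \<noteq> b\<close> by (simp add: sums_iff add.commute)
qed

definition volume :: "'a pair_pre_digraph \<Rightarrow> real" where
  "volume G = (\<Sum>x\<in>pverts G. real (card (neighbours G x)))"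

lemma volume_pos:
  assumes G: "connected_graph G" and ab: "a \<in> pverts G" "b \<in> pverts G" "a \<noteq> b"
  shows "0 < volume G"
  unfolding volume_def
  using connected_graph_finite[OF G] ab(1) neighbours_nonempty[OF G ab]
    neighbours_finite[OF connected_graph_pair_graph[OF G]]
  by (intro sum_pos2[of _ a]) (auto simp: card_gt_0_iff)

text \<open>
  Away from the target this is the first-step equation; at the target it is forced because a
  Laplacian sums to 0.
\<close>

lemma laplacian_mean_hitting_time:
  assumes G: "connected_graph G" and x: "x \<in> pverts G" and b: "b \<in> pverts G"
  shows "laplacian G (mean_hitting_time G b) x =
    card (neighbours G x) - of_bool (x = b) * volume G"
proof -
  note pg = connected_graph_pair_graph[OF G]
  let ?L = "laplacian G (mean_hitting_time G b)"
  have off: "?L y = card (neighbours G y)" if y: "y \<in> pverts G" "y \<noteq> b" for y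
  proof -
    have "card (neighbours G y) \<noteq> 0"
      using neighbours_nonempty[OF G y(1) b y(2) y(1)] neighbours_finite[OF pg] by simp
    then show ?thesis
      using mean_hitting_time_step[OF G y(1) b y(2)]
      by (simp add: laplacian_def sum_subtractf field_simps)
  qed
  show ?thesis
  proof (cases "x = b")
    case True
    have "0 = (\<Sum>y\<in>pverts G. ?L y)" by (simp add: sum_laplacian[OF pg])
    also have "\<dots> = ?L b + (\<Sum>y\<in>pverts G - {b}. ?L y)"
      using connected_graph_finite[OF G] b by (rule sum.remove)
    also have "(\<Sum>y\<in>pverts G - {b}. ?L y) = (\<Sum>y\<in>pverts G - {b}. real (card (neighbours G y)))"
      by (intro sum.cong off) auto
    also have "\<dots> = volume G - card (neighbours G b)"
      unfolding volume_def using connected_graph_finite[OF G] b by (subst sum.remove[of _ b]) auto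
    finally show ?thesis using True by simp
  qed (use off x in simp)
qed

text \<open>The degree terms in the two Laplacians cancel, leaving a source at \<open>i\<close> and a sink at \<open>j\<close>.\<close>

lemma potential_by_hitting_times:
  assumes G: "connected_graph G" and ij: "i \<in> pverts G" "j \<in> pverts G" "i \<noteq> j"
  shows "unit_current_potential G i j
    (\<lambda>x. (mean_hitting_time G j x - mean_hitting_time G i x) / volume G)"
  unfolding unit_current_potential_iff_laplacian
  using ij volume_pos[OF assms]
  by (auto simp: laplacian_divide laplacian_diff laplacian_mean_hitting_time[OF G])

lemma unit_current_potential_exists:
  assumes "connected_graph G" "i \<in> pverts G" "j \<in> pverts G"
  shows "\<exists>\<phi>. unit_current_potential G i j \<phi>"
proof (cases "i = j")
  case True
  then have "unit_current_potential G i j (\<lambda>x. 0)"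
    by (simp add: unit_current_potential_iff_laplacian)
  then show ?thesis by blast
next
  case False
  from potential_by_hitting_times[OF assms this] show ?thesis by blast
qed

lemma commute_time_identity:
  assumes G: "connected_graph G" and ij: "i \<in> pverts G" "j \<in> pverts G"
  shows "effective_resistance G i j = (mean_hitting_time G j i + mean_hitting_time G i j) / volume G"
proof (cases "i = j")
  case False
  from effective_resistance_eq[OF G ij potential_by_hitting_times[OF G ij False]]
  show ?thesis by (simp add: diff_divide_distrib[symmetric] add_divide_distrib[symmetric])
qed (simp add: effective_resistance_self[OF G ij(2)])

text \<open>
  The random target lemma: the left-hand side is harmonic in the starting vertex \<open>a\<close>, since at \<open>x\<close>
  its Laplacian is \<open>\<Sum>\<^sub>b deg(b) (deg(x) - vol \<delta>\<^sub>b(x)) = vol deg(x) - deg(x) vol\<close>.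
\<close>

lemma random_target:
  assumes G: "connected_graph G" and ac: "a \<in> pverts G" "c \<in> pverts G"
  shows "(\<Sum>b\<in>pverts G. card (neighbours G b) * mean_hitting_time G b a) =
    (\<Sum>b\<in>pverts G. card (neighbours G b) * mean_hitting_time G b c)"
proof (rule harmonic_constant[OF G _ ac])
  fix x assume x: "x \<in> pverts G"
  let ?d = "\<lambda>b. real (card (neighbours G b))"
  have "laplacian G (\<lambda>a. \<Sum>b\<in>pverts G. ?d b * mean_hitting_time G b a) x =
      (\<Sum>b\<in>pverts G. ?d b * (?d x - of_bool (x = b) * volume G))"
    unfolding laplacian_sum laplacian_cmult
    using laplacian_mean_hitting_time[OF G x] by (intro sum.cong) auto
  also have "\<dots> = volume G * ?d x - (\<Sum>b\<in>pverts G. if x = b then ?d b * volume G else 0)"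
    unfolding right_diff_distrib sum_subtractf
    by (intro arg_cong2[of _ _ _ _ minus]) (auto simp: volume_def sum_distrib_right intro!: sum.cong)
  also have "\<dots> = 0" using x connected_graph_finite[OF G] by simp
  finally show "laplacian G (\<lambda>a. \<Sum>b\<in>pverts G. ?d b * mean_hitting_time G b a) x = 0" .
qed


section \<open>Expected hitting times of the random walk\<close>

lemma less_hitting_time_iff: "enat n < hitting_time b X \<longleftrightarrow> (\<forall>i\<le>n. X i \<noteq> b)"
proof
  assume *: "enat n < hitting_time b X"
  show "\<forall>i\<le>n. X i \<noteq> b"
  proof (intro allI impI notI)
    fix i assume "i \<le> n" "X i = b"
    then have "hitting_time b X \<le> enat i" unfolding hitting_time_def by (intro Inf_lower) auto
    also have "\<dots> \<le> enat n" using \<open>i \<le> n\<close> by simp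
    finally show False using * by simp
  qed
next
  assume *: "\<forall>i\<le>n. X i \<noteq> b"
  have "enat (Suc n) \<le> hitting_time b X"
    unfolding hitting_time_def
  proof (rule Inf_greatest)
    fix k assume "k \<in> {enat m | m. X m = b}"
    then obtain m where "k = enat m" "X m = b" by auto
    then show "enat (Suc n) \<le> k" using * by (auto simp: not_less_eq_eq[symmetric])
  qed
  then show "enat n < hitting_time b X" by (rule order_less_le_trans[rotated]) simp
qed

lemma ennreal_of_enat_eq_suminf: "ennreal_of_enat N = (\<Sum>n. of_bool (enat n < N))"
proof -
  have "(\<lambda>n. if enat n < N then 1 else 0) sums ennreal_of_enat N"
    using sums_If_finite[of "\<lambda>n. n < N" "\<lambda>_. 1 :: ennreal"]
    by (cases N) (simp_all add: sums_def of_nat_tendsto_top_ennreal)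
  then show ?thesis by (simp add: sums_iff of_bool_def)
qed

definition avoiding ::
  "'a pair_pre_digraph \<Rightarrow> 'a \<Rightarrow> nat \<Rightarrow> 'a \<Rightarrow> ('a \<Rightarrow> 'a) stream set" where
  "avoiding G b n a = {\<omega>\<in>space (walk_space G). \<forall>i\<le>n. walk a \<omega> i \<noteq> b}"

context
  fixes G :: "'a pair_pre_digraph"
  assumes G: "pair_graph G" and nbrs: "\<And>x. x \<in> pverts G \<Longrightarrow> neighbours G x \<noteq> {}"
begin

private abbreviation "steps \<equiv> \<Pi>\<^sub>M x\<in>pverts G. uniform_count_measure (neighbours G x)"

lemma sets_avoiding:
  assumes "a \<in> pverts G"
  shows "avoiding G b n a \<in> sets (walk_space G)"
proof -
  let ?W = "walk_space G"
  have "(\<lambda>\<omega>. walk a \<omega> i) -` (pverts G - {b}) \<inter> space ?W \<in> sets ?W" for i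
    by (rule measurable_sets[OF measurable_walk[OF G nbrs assms]]) auto
  moreover have "(\<lambda>\<omega>. walk a \<omega> i) -` (pverts G - {b}) \<inter> space ?W =
      {\<omega>\<in>space ?W. walk a \<omega> i \<noteq> b}" for i
    using measurable_space[OF measurable_walk[OF G nbrs assms]] by auto
  ultimately have *: "{\<omega>\<in>space ?W. walk a \<omega> i \<noteq> b} \<in> sets ?W" for i by simp
  have "{\<omega>\<in>space ?W. \<forall>i\<in>{..n}. walk a \<omega> i \<noteq> b} \<in> sets ?W"
    by (rule sets.sets_Collect_finite_All[where P = "\<lambda>i \<omega>. walk a \<omega> i \<noteq> b", OF * finite_atMost])
  then show ?thesis by (simp only: avoiding_def Ball_def atMost_iff)
qed

lemma nn_integral_uniform_step:
  assumes a: "a \<in> pverts G"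
  shows "(\<integral>\<^sup>+f. F (f a) \<partial>steps) =
    (\<Sum>y\<in>neighbours G a. ennreal (1 / card (neighbours G a)) * F y)"
proof -
  let ?U = "uniform_count_measure (neighbours G a)"
  have "(\<integral>\<^sup>+f. F (f a) \<partial>steps) = (\<integral>\<^sup>+y. F y \<partial>distr steps ?U (\<lambda>f. f a))"
    using a by (intro nn_integral_distr[symmetric] measurable_component_singleton)
      (auto simp: measurable_def space_uniform_count_measure sets_uniform_count_measure)
  also have "distr steps ?U (\<lambda>f. f a) = ?U"
    by (rule distr_PiM_component[OF prob_space_step[OF G nbrs] a])
  also have "(\<integral>\<^sup>+y. F y \<partial>?U) = (\<Sum>y\<in>neighbours G a. ennreal (1 / card (neighbours G a)) * F y)"
    unfolding uniform_count_measure_def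
    using neighbours_finite[OF G] by (simp add: nn_integral_point_measure_finite mult_ac)
  finally show ?thesis .
qed

text \<open>
  The Markov property at time 1: once the first random map \<open>f\<close> is removed from the driving sequence,
  the rest drives a fresh walk from \<open>f a\<close>, a uniform neighbour of \<open>a\<close>. This turns the
  probability of avoiding the target into the recursion that defines \<open>survival\<close>.
\<close>

lemma emeasure_avoiding:
  assumes "a \<in> pverts G"
  shows "emeasure (walk_space G) (avoiding G b n a) = ennreal (survival G b n a)"
  using assms
proof (induction n arbitrary: a)
  case 0
  have "avoiding G b 0 a = (if a = b then {} else space (walk_space G))"
    by (auto simp: avoiding_def)
  then show ?case
    using prob_space.emeasure_space_1[OF prob_space_walk_space[OF G nbrs]] by simp
next
  case (Suc n)
  let ?W = "walk_space G"
  let ?N = "neighbours G a"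
  have rec: "f ## \<omega> \<in> avoiding G b (Suc n) a \<longleftrightarrow> a \<noteq> b \<and> \<omega> \<in> avoiding G b n (f a)"
    if "f \<in> space steps" for f \<omega>
  proof -
    have "f ## \<omega> \<in> space ?W \<longleftrightarrow> \<omega> \<in> space ?W"
      using that by (auto simp: walk_space_def space_stream_space streams_Stream)
    moreover have "(\<forall>i\<le>Suc n. Q i) \<longleftrightarrow> Q 0 \<and> (\<forall>i\<le>n. Q (Suc i))" for Q
      by (metis Suc_le_mono le0 not0_implies_Suc)
    ultimately show ?thesis
      unfolding avoiding_def mem_Collect_eq by (auto simp only: walk_Stream_Suc[OF G nbrs] walk.simps(1))
  qed
  have step_in: "f a \<in> pverts G" if "f \<in> space steps" for f
    using that Suc.prems neighbours_subset[OF G, of a]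
    by (auto simp: space_PiM space_uniform_count_measure PiE_iff)
  have "emeasure ?W (avoiding G b (Suc n) a) = (\<integral>\<^sup>+\<omega>. indicator (avoiding G b (Suc n) a) \<omega> \<partial>?W)"
    by (rule nn_integral_indicator[OF sets_avoiding[OF Suc.prems], symmetric])
  also have "\<dots> = (\<integral>\<^sup>+f. \<integral>\<^sup>+\<omega>. indicator (avoiding G b (Suc n) a) (f ## \<omega>) \<partial>?W \<partial>steps)"
    using sets_avoiding[OF Suc.prems, of b "Suc n"] unfolding walk_space_def
    by (intro prob_space.nn_integral_stream_space[OF prob_space_steps[OF G nbrs]]
        borel_measurable_indicator)
  also have "\<dots> = (\<integral>\<^sup>+f. of_bool (a \<noteq> b) * emeasure ?W (avoiding G b n (f a)) \<partial>steps)"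
  proof (intro nn_integral_cong)
    fix f assume f: "f \<in> space steps"
    have "(\<integral>\<^sup>+\<omega>. indicator (avoiding G b (Suc n) a) (f ## \<omega>) \<partial>?W) =
       (\<integral>\<^sup>+\<omega>. of_bool (a \<noteq> b) * indicator (avoiding G b n (f a)) \<omega> \<partial>?W)"
      using rec[OF f] by (intro nn_integral_cong) (simp add: indicator_def)
    also have "\<dots> = of_bool (a \<noteq> b) * emeasure ?W (avoiding G b n (f a))"
      using sets_avoiding[OF step_in[OF f]] by (simp add: nn_integral_cmult)
    finally show "(\<integral>\<^sup>+\<omega>. indicator (avoiding G b (Suc n) a) (f ## \<omega>) \<partial>?W) = \<dots>" .
  qed
  also have "\<dots> = (\<Sum>y\<in>?N. ennreal (1 / card ?N) *
      (of_bool (a \<noteq> b) * emeasure ?W (avoiding G b n y)))"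
    by (rule nn_integral_uniform_step[OF Suc.prems])
  also have "\<dots> = (\<Sum>y\<in>?N. ennreal (1 / card ?N * (of_bool (a \<noteq> b) * survival G b n y)))"
  proof (intro sum.cong refl)
    fix y assume "y \<in> ?N"
    then have "y \<in> pverts G" using neighbours_subset[OF G] by blast
    from Suc.IH[OF this]
    show "ennreal (1 / card ?N) * (of_bool (a \<noteq> b) * emeasure ?W (avoiding G b n y)) =
        ennreal (1 / card ?N * (of_bool (a \<noteq> b) * survival G b n y))"
      by (cases "a = b") (simp_all only: of_bool_eq ennreal_mult'' survival_nonneg simp_thms
          mult_zero_left mult_zero_right mult_1_left ennreal_0)
  qed
  also have "\<dots> = ennreal (\<Sum>y\<in>?N. 1 / card ?N * (of_bool (a \<noteq> b) * survival G b n y))"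
    by (intro sum_ennreal mult_nonneg_nonneg survival_nonneg) auto
  also have "(\<Sum>y\<in>?N. 1 / card ?N * (of_bool (a \<noteq> b) * survival G b n y)) = survival G b (Suc n) a"
    by (simp add: sum_divide_distrib)
  finally show ?case .
qed

end

text \<open>The expectation of the hitting time is the sum of its tail probabilities.\<close>

lemma expected_hitting_time_eq:
  assumes G: "connected_graph G" and ab: "a \<in> pverts G" "b \<in> pverts G"
    and nbrs: "\<And>x. x \<in> pverts G \<Longrightarrow> neighbours G x \<noteq> {}"
  shows "expected_hitting_time G a b = ennreal (mean_hitting_time G b a)"
proof -
  note pg = connected_graph_pair_graph[OF G]
  let ?W = "walk_space G"
  have "expected_hitting_time G a b =
      (\<integral>\<^sup>+\<omega>. (\<Sum>n. indicator (avoiding G b n a) \<omega>) \<partial>?W)"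
    unfolding expected_hitting_time_def ennreal_of_enat_eq_suminf less_hitting_time_iff
    by (intro nn_integral_cong suminf_cong) (simp add: avoiding_def indicator_def)
  also have "\<dots> = (\<Sum>n. \<integral>\<^sup>+\<omega>. indicator (avoiding G b n a) \<omega> \<partial>?W)"
    by (intro nn_integral_suminf borel_measurable_indicator sets_avoiding[OF pg nbrs] ab)
  also have "\<dots> = (\<Sum>n. ennreal (survival G b n a))"
    using sets_avoiding[OF pg nbrs ab(1)] emeasure_avoiding[OF pg nbrs ab(1)] by simp
  also have "\<dots> = ennreal (mean_hitting_time G b a)"
    unfolding mean_hitting_time_def
    by (intro suminf_ennreal_eq survival_nonneg summable_sums survival_summable G ab)
  finally show ?thesis .
qed

text \<open>
  Symmetry of the extended-real expectations transfers to the real mean hitting times because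
  the latter represent them. Two distinct vertices ensure that every vertex has a neighbour.
\<close>

lemma highly_symmetric_mean_hitting_time:
  assumes G: "connected_graph G" and hs: "highly_symmetric G"
    and ab: "a \<in> pverts G" "b \<in> pverts G"
  shows "mean_hitting_time G b a = mean_hitting_time G a b"
proof (cases "a = b")
  case False
  note eq = expected_hitting_time_eq[OF G _ _ neighbours_nonempty[OF G ab False]]
  have "ennreal (mean_hitting_time G b a) = ennreal (mean_hitting_time G a b)"
    using hs ab unfolding highly_symmetric_def by (simp add: eq[symmetric])
  then show ?thesis using mean_hitting_time_nonneg[OF G] ab by simp
qed simp

text \<open>
  With \<open>d\<close> the common degree, the sum at \<open>t\<close> is \<open>2 / (d vol)\<close> times the random target sum
  started at \<open>t\<close>.
\<close>

lemma sum_effective_resistance_constant: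
  assumes G: "connected_graph G" and reg: "regular_graph G" and hs: "highly_symmetric G"
    and rs: "r \<in> pverts G" "s \<in> pverts G"
  shows "(\<Sum>x\<in>pverts G. effective_resistance G x r) = (\<Sum>x\<in>pverts G. effective_resistance G x s)"
proof (cases "r = s")
  case False
  obtain d where d: "card (neighbours G x) = d" if "x \<in> pverts G" for x
    using reg unfolding regular_graph_def by blast
  have "d \<noteq> 0"
    using d[OF rs(1)] neighbours_nonempty[OF G rs False rs(1)]
      neighbours_finite[OF connected_graph_pair_graph[OF G], of r] by auto
  have row: "(\<Sum>x\<in>pverts G. effective_resistance G x t) =
      (\<Sum>x\<in>pverts G. card (neighbours G x) * mean_hitting_time G x t) * (2 / (d * volume G))"
    if t: "t \<in> pverts G" for t
    unfolding sum_distrib_right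
  proof (intro sum.cong refl)
    fix x assume x: "x \<in> pverts G"
    show "effective_resistance G x t =
        card (neighbours G x) * mean_hitting_time G x t * (2 / (d * volume G))"
      using \<open>d \<noteq> 0\<close> by (simp add: commute_time_identity[OF G x t] d[OF x]
          highly_symmetric_mean_hitting_time[OF G hs x t])
  qed
  show ?thesis by (simp add: row rs random_target[OF G rs])
qed simp


section \<open>Resistances in a cluster\<close>

text \<open>Only the roots carry edges of \<open>G1\<close>, and these lead to other roots.\<close>

lemma laplacian_cluster:
  assumes G1: "pair_graph G1" and G2: "pair_graph G2" and u: "u \<in> pverts G1"
  shows "laplacian (cluster G1 G2 r) \<Phi> (u, z) =
    laplacian G2 (\<lambda>y. \<Phi> (u, y)) z + of_bool (z = r) * laplacian G1 (\<lambda>w. \<Phi> (w, r)) u"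
proof -
  interpret G1: pair_graph G1 by (rule G1)
  let ?A = "Pair u ` neighbours G2 z"
  let ?B = "if z = r then (\<lambda>w. (w, r)) ` neighbours G1 u else {}"
  have "neighbours (cluster G1 G2 r) (u, z) = ?A \<union> ?B"
    using u by (auto simp: neighbours_def cluster_def)
  moreover have "?A \<inter> ?B = {}"
    by (auto simp: neighbours_def dest: G1.no_loops')
  moreover have "finite ?A" "finite ?B"
    using neighbours_finite[OF G1] neighbours_finite[OF G2] by auto
  ultimately have "laplacian (cluster G1 G2 r) \<Phi> (u, z) =
      (\<Sum>p\<in>?A. \<Phi> (u, z) - \<Phi> p) + (\<Sum>p\<in>?B. \<Phi> (u, z) - \<Phi> p)"
    unfolding laplacian_def by (simp only: sum.union_disjoint)
  then show ?thesis
    by (auto simp: laplacian_def sum.reindex inj_on_def)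
qed

context
  fixes G1 :: "'a pair_pre_digraph" and G2 :: "'b pair_pre_digraph" and r :: 'b
  assumes G1: "connected_graph G1" and G2: "connected_graph G2" and r: "r \<in> pverts G2"
begin

text \<open>
  A potential on the copy of \<open>G2\<close> at \<open>v\<close> extends to the cluster by the constant value that it has
  at the root: shifted to vanish at the root, it is continued by 0 and drives no current in \<open>G1\<close>.
\<close>

lemma effective_resistance_cluster_same:
  assumes v: "v \<in> pverts G1" and x: "x \<in> pverts G2" and y: "y \<in> pverts G2"
  shows "effective_resistance (cluster G1 G2 r) (v, x) (v, y) = effective_resistance G2 x y"
proof -
  obtain \<phi> where \<phi>: "unit_current_potential G2 x y \<phi>"
    using unit_current_potential_exists[OF G2 x y] by blast
  let ?\<Phi> = "\<lambda>(u, z). of_bool (u = v) * (\<phi> z - \<phi> r)"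
  have "unit_current_potential (cluster G1 G2 r) (v, x) (v, y) ?\<Phi>"
    unfolding unit_current_potential_iff_laplacian
  proof
    fix p assume "p \<in> pverts (cluster G1 G2 r)"
    then obtain u z where p: "p = (u, z)" "u \<in> pverts G1" "z \<in> pverts G2"
      by (auto simp: cluster_def)
    have "laplacian G2 \<phi> z = of_bool (z = x) - of_bool (z = y)"
      using \<phi> p by (simp add: unit_current_potential_iff_laplacian)
    then show "laplacian (cluster G1 G2 r) ?\<Phi> p = of_bool (p = (v, x)) - of_bool (p = (v, y))"
      unfolding p(1) laplacian_cluster[OF connected_graph_pair_graph[OF G1]
          connected_graph_pair_graph[OF G2] p(2)]
      by (simp add: laplacian_cmult laplacian_diff)
  qed
  moreover have "(v, x) \<in> pverts (cluster G1 G2 r)" "(v, y) \<in> pverts (cluster G1 G2 r)"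
    using v x y by (auto simp: cluster_def)
  ultimately have "effective_resistance (cluster G1 G2 r) (v, x) (v, y) = ?\<Phi> (v, x) - ?\<Phi> (v, y)"
    using effective_resistance_eq[OF connected_graph_cluster[OF G1 G2 r]] by blast
  then show ?thesis using effective_resistance_eq[OF G2 x y \<phi>] by simp
qed

text \<open>
  Resistors in series: the potentials on the two copies, shifted to vanish at the root, are added
  to the potential on \<open>G1\<close>, taken constant on each copy. The currents \<open>x \<rightarrow> r\<close>, \<open>v \<rightarrow> w\<close> and
  \<open>r \<rightarrow> y\<close> then meet at the two roots, where sources and sinks cancel.
\<close>

lemma effective_resistance_cluster_distinct:
  assumes v: "v \<in> pverts G1" and w: "w \<in> pverts G1" and "v \<noteq> w"
    and x: "x \<in> pverts G2" and y: "y \<in> pverts G2"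
  shows "effective_resistance (cluster G1 G2 r) (v, x) (w, y) =
    effective_resistance G2 x r + effective_resistance G1 v w + effective_resistance G2 r y"
proof -
  obtain \<phi> where \<phi>: "unit_current_potential G2 x r \<phi>"
    using unit_current_potential_exists[OF G2 x r] by blast
  obtain \<eta> where \<eta>: "unit_current_potential G1 v w \<eta>"
    using unit_current_potential_exists[OF G1 v w] by blast
  obtain \<psi> where \<psi>: "unit_current_potential G2 r y \<psi>"
    using unit_current_potential_exists[OF G2 r y] by blast
  let ?\<Phi> = "\<lambda>(u, z). \<eta> u + (of_bool (u = v) * (\<phi> z - \<phi> r) + of_bool (u = w) * (\<psi> z - \<psi> r))"
  have "unit_current_potential (cluster G1 G2 r) (v, x) (w, y) ?\<Phi>"
    unfolding unit_current_potential_iff_laplacian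
  proof
    fix p assume "p \<in> pverts (cluster G1 G2 r)"
    then obtain u z where p: "p = (u, z)" "u \<in> pverts G1" "z \<in> pverts G2"
      by (auto simp: cluster_def)
    have "laplacian G2 \<phi> z = of_bool (z = x) - of_bool (z = r)"
      "laplacian G2 \<psi> z = of_bool (z = r) - of_bool (z = y)"
      "laplacian G1 \<eta> u = of_bool (u = v) - of_bool (u = w)"
      using \<phi> \<psi> \<eta> p by (simp_all add: unit_current_potential_iff_laplacian)
    then show "laplacian (cluster G1 G2 r) ?\<Phi> p = of_bool (p = (v, x)) - of_bool (p = (w, y))"
      unfolding p(1) laplacian_cluster[OF connected_graph_pair_graph[OF G1]
          connected_graph_pair_graph[OF G2] p(2)]
      by (simp add: laplacian_add laplacian_cmult laplacian_diff)
  qed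
  moreover have "(v, x) \<in> pverts (cluster G1 G2 r)" "(w, y) \<in> pverts (cluster G1 G2 r)"
    using v w x y by (auto simp: cluster_def)
  ultimately have "effective_resistance (cluster G1 G2 r) (v, x) (w, y) = ?\<Phi> (v, x) - ?\<Phi> (w, y)"
    using effective_resistance_eq[OF connected_graph_cluster[OF G1 G2 r]] by blast
  then show ?thesis
    using effective_resistance_eq[OF G2 x r \<phi>] effective_resistance_eq[OF G2 r y \<psi>]
      effective_resistance_eq[OF G1 v w \<eta>] \<open>v \<noteq> w\<close> by simp
qed

text \<open>
  Each of the \<open>n1 (n1 - 1)\<close> ordered pairs of distinct copies contributes, besides the resistance in
  \<open>G1\<close>, the resistances to the root in both copies, each of them \<open>n2\<close> times.
\<close>

lemma kirchhoff_index_cluster: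
  defines "n1 \<equiv> real (card (pverts G1))" and "n2 \<equiv> real (card (pverts G2))"
  shows "kirchhoff_index (cluster G1 G2 r) = n2\<^sup>2 * kirchhoff_index G1 + n1 * kirchhoff_index G2
    + n1 * (n1 - 1) * n2 * (\<Sum>x\<in>pverts G2. effective_resistance G2 x r)"
proof -
  let ?C = "cluster G1 G2 r"
  let ?V1 = "pverts G1" and ?V2 = "pverts G2"
  let ?s = "\<Sum>x\<in>?V2. effective_resistance G2 x r"
  have block: "(\<Sum>x\<in>?V2. \<Sum>y\<in>?V2. effective_resistance ?C (v, x) (w, y)) =
      n2\<^sup>2 * effective_resistance G1 v w +
      (if v = w then 2 * kirchhoff_index G2 else 2 * n2 * ?s)"
    if v: "v \<in> ?V1" and w: "w \<in> ?V1" for v w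
  proof (cases "v = w")
    case True
    then show ?thesis
      using w by (simp add: effective_resistance_cluster_same effective_resistance_self[OF G1]
          kirchhoff_index_eq_double_sum[OF G2])
  next
    case False
    have "(\<Sum>x\<in>?V2. \<Sum>y\<in>?V2. effective_resistance ?C (v, x) (w, y)) =
        (\<Sum>x\<in>?V2. \<Sum>y\<in>?V2. effective_resistance G2 x r + effective_resistance G1 v w
          + effective_resistance G2 y r)"
      using effective_resistance_cluster_distinct[OF v w False]
      by (intro sum.cong refl) (simp add: effective_resistance_commute[of G2 r])
    also have "\<dots> = n2 * ?s + n2 * (n2 * effective_resistance G1 v w) + n2 * ?s"
      by (simp add: sum.distrib n2_def sum_distrib_left[symmetric] distrib_left)
    finally show ?thesis using False by (simp add: power2_eq_square)
  qed
  have "2 * kirchhoff_index ?C =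
      (\<Sum>(v, x)\<in>?V1 \<times> ?V2. \<Sum>(w, y)\<in>?V1 \<times> ?V2. effective_resistance ?C (v, x) (w, y))"
    unfolding kirchhoff_index_eq_double_sum[OF connected_graph_cluster[OF G1 G2 r]]
    by (simp add: cluster_def case_prod_unfold)
  also have "\<dots> = (\<Sum>v\<in>?V1. \<Sum>x\<in>?V2. \<Sum>w\<in>?V1. \<Sum>y\<in>?V2. effective_resistance ?C (v, x) (w, y))"
    by (simp only: sum.cartesian_product[symmetric] prod.case)
  also have "\<dots> = (\<Sum>v\<in>?V1. \<Sum>w\<in>?V1. \<Sum>x\<in>?V2. \<Sum>y\<in>?V2. effective_resistance ?C (v, x) (w, y))"
    by (intro sum.cong refl sum.swap)
  also have "\<dots> = (\<Sum>v\<in>?V1. \<Sum>w\<in>?V1. n2\<^sup>2 * effective_resistance G1 v w +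
      (if v = w then 2 * kirchhoff_index G2 else 2 * n2 * ?s))"
    by (intro sum.cong refl block)
  also have "\<dots> = (\<Sum>v\<in>?V1. \<Sum>w\<in>?V1. n2\<^sup>2 * effective_resistance G1 v w) +
      (\<Sum>v\<in>?V1. 2 * kirchhoff_index G2 + (n1 - 1) * (2 * n2 * ?s))"
  proof -
    have "(\<Sum>w\<in>?V1. if v = w then 2 * kirchhoff_index G2 else 2 * n2 * ?s) =
        2 * kirchhoff_index G2 + (n1 - 1) * (2 * n2 * ?s)" if v: "v \<in> ?V1" for v
    proof -
      have fin: "finite ?V1" by (rule connected_graph_finite[OF G1])
      have "(\<Sum>w\<in>?V1 - {v}. if v = w then 2 * kirchhoff_index G2 else 2 * n2 * ?s) =
          (\<Sum>w\<in>?V1 - {v}. 2 * n2 * ?s)"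
        by (intro sum.cong) auto
      moreover have "real (card (?V1 - {v})) = n1 - 1"
        using fin v card_gt_0_iff[of ?V1] by (auto simp: n1_def of_nat_diff)
      ultimately show ?thesis by (subst sum.remove[OF fin v]) simp
    qed
    then show ?thesis by (simp add: sum.distrib)
  qed
  also have "\<dots> = 2 * (n2\<^sup>2 * kirchhoff_index G1 + n1 * kirchhoff_index G2 + n1 * (n1 - 1) * n2 * ?s)"
    unfolding sum_distrib_left[symmetric] kirchhoff_index_eq_double_sum[OF G1, symmetric]
    by (simp add: n1_def algebra_simps)
  finally show ?thesis by simp
qed

end

theorem proposition2:
  fixes G1 :: "'a pair_pre_digraph" and G2 :: "'b pair_pre_digraph"
    and r :: 'b and n1 n2 :: nat
  assumes "connected_graph G1" and "card (pverts G1) = n1"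
    and "connected_graph G2" and "card (pverts G2) = n2"
    and "regular_graph G2" and "highly_symmetric G2"
    and "r \<in> pverts G2"
  shows "kirchhoff_index (cluster G1 G2 r) =
    (real n2)\<^sup>2 * kirchhoff_index G1 + (2 * (real n1)\<^sup>2 - real n1) * kirchhoff_index G2"
proof -
  have "2 * kirchhoff_index G2 = (\<Sum>s\<in>pverts G2. \<Sum>x\<in>pverts G2. effective_resistance G2 x s)"
    unfolding kirchhoff_index_eq_double_sum[OF assms(3)] by (rule sum.swap)
  also have "\<dots> = (\<Sum>s\<in>pverts G2. \<Sum>x\<in>pverts G2. effective_resistance G2 x r)"
    by (intro sum.cong refl sum_effective_resistance_constant assms)
  also have "\<dots> = n2 * (\<Sum>x\<in>pverts G2. effective_resistance G2 x r)"
    using assms(4) by simp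
  finally have *: "n2 * (\<Sum>x\<in>pverts G2. effective_resistance G2 x r) = 2 * kirchhoff_index G2" ..
  show ?thesis
    unfolding kirchhoff_index_cluster[OF assms(1,3,7)] assms(2,4) mult.assoc *
    by (simp add: power2_eq_square algebra_simps)
qed

end
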